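(* Let $q\in\mathbb{C}[z]$ be a monic polynomial of degree $d$. Then $$[f\circ q,\,g\circ q]_{nd}=[T_{q,n}(f),\,g]_n$$ for all $f,g\in\mathbb{C}[z]_n$.
   Context: $\mathbb{C}[z]_m$ is the space of complex polynomials of degree at most $m$. For $f=\sum_{k=0}^m a_kz^k$, $g=\sum_{k=0}^m b_kz^k$ in $\mathbb{C}[z]_m$, the Fischer inner product is $\langle f,g\rangle_m=\sum_{k=0}^m\frac{1}{\binom{m}{k}}a_k\overline{b_k}$. For $f=\sum_{k=0}^m a_kz^k$ regarded as an element of $\mathbb{C}[z]_m$, put $f^\vee(z)=f(-z)$, $f^\#(z)=z^m\overline{f(1/\overline{z})}=\sum_{k=0}^m\overline{a_{m-k}}z^k$ (this depends on $m$), and $f^{\#\vee}=(f^\#)^\vee$. The apolarity form on $\mathbb{C}[z]_m$ is the bilinear form $[f,g]_m=\langle f,g^{\#\vee}\rangle_m$. For $q$ monic of degree $d$ and $f\in\mathbb{C}[z]_n$, define $$S_{q,n}(f)(u_1,\dots,u_n)=\Bigl\langle f\circ q,\ \prod_{j=1}^n(q-u_j)^{\#\vee}\Bigr\rangle_{nd},\qquad T_{q,n}(f)(z)=S_{q,n}(f)(z,\dots,z),$$ where each $q-u_j$ is regarded as an element of $\mathbb{C}[z]_d$ when forming $(q-u_j)^{\#\vee}$. In $[f\circ q,g\circ q]_{nd}$ the polynomials $f\circ q$, $g\circ q$ are regarded as elements of $\mathbb{C}[z]_{nd}$. *)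

theory Defs
  imports Complex_Main "HOL-Computational_Algebra.Polynomial"
begin

text \<open>
  The space of complex polynomials of degree at most \<open>m\<close> is rendered as the type \<^typ>\<open>complex poly\<close>
  together with the side condition \<open>degree f \<le> m\<close>; every notion depending on the ambient space
  takes \<open>m\<close> as an explicit parameter and is only meaningful under that condition.
\<close>

definition fischer :: "nat \<Rightarrow> complex poly \<Rightarrow> complex poly \<Rightarrow> complex" where
  "fischer m f g = (\<Sum>k\<le>m. 1 / of_nat (m choose k) * coeff f k * cnj (coeff g k))"

definition vee :: "complex poly \<Rightarrow> complex poly" where
  "vee f = f \<circ>\<^sub>p [:0, -1:]"

definition sharp :: "nat \<Rightarrow> complex poly \<Rightarrow> complex poly" where
  "sharp m f = (\<Sum>k\<le>m. monom (cnj (coeff f (m - k))) k)"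

definition apolar :: "nat \<Rightarrow> complex poly \<Rightarrow> complex poly \<Rightarrow> complex" where
  "apolar m f g = fischer m f (vee (sharp m g))"

definition S_op :: "complex poly \<Rightarrow> nat \<Rightarrow> complex poly \<Rightarrow> (nat \<Rightarrow> complex) \<Rightarrow> complex" where
  "S_op q n f u =
     fischer (n * degree q) (f \<circ>\<^sub>p q) (\<Prod>j=1..n. vee (sharp (degree q) (q - [:u j:])))"

text \<open>
  \<open>T_op q n f\<close> is the polynomial whose values are those of \<open>S_op\<close> on the diagonal; the lemmas
  \<open>poly_T_op\<close> and \<open>degree_T_op\<close> below show that it exists and has degree at most \<open>n\<close>.
\<close>

definition T_op :: "complex poly \<Rightarrow> nat \<Rightarrow> complex poly \<Rightarrow> complex poly" where
  "T_op q n f = (THE p. \<forall>z. poly p z = S_op q n f (\<lambda>_. z))"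

lemma poly_sharp:
  assumes "degree f \<le> m" "z \<noteq> 0"
  shows "poly (sharp m f) z = z ^ m * cnj (poly f (1 / cnj z))"
proof -
  have "poly f (1 / cnj z) = (\<Sum>k\<le>m. coeff f k * (1 / cnj z) ^ k)"
    unfolding poly_altdef using assms(1)
    by (intro sum.mono_neutral_left) (auto simp: coeff_eq_0)
  then have "z ^ m * cnj (poly f (1 / cnj z)) = (\<Sum>k\<le>m. z ^ m * (cnj (coeff f k) * (1 / z) ^ k))"
    by (simp add: sum_distrib_left)
  also have "\<dots> = (\<Sum>k\<le>m. cnj (coeff f k) * z ^ (m - k))"
    using assms(2) by (intro sum.cong) (auto simp: power_diff field_simps)
  also have "\<dots> = (\<Sum>k\<le>m. cnj (coeff f (m - k)) * z ^ k)"
    by (rule sum.reindex_bij_witness[of _ "\<lambda>k. m - k" "\<lambda>k. m - k"]) auto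
  finally show ?thesis
    by (simp add: sharp_def poly_sum poly_monom)
qed

lemma T_op_aux:
  "\<exists>p. degree p \<le> n \<and> (\<forall>z. poly p z = S_op q n f (\<lambda>_. z))"
proof -
  define d where "d = degree q"
  define A where "A = vee (sharp d q)"
  define B where "B = vee (monom 1 d)"
  define c where "c = (\<lambda>i. \<Sum>k\<le>n * d. 1 / of_nat ((n * d) choose k) * coeff (f \<circ>\<^sub>p q) k *
     cnj (coeff (of_nat (n choose i) * (- B) ^ i * A ^ (n - i)) k))"
  have sh: "sharp d (q - [:z:]) = sharp d q - smult (cnj z) (monom 1 d)" for z
  proof (rule poly_eqI)
    fix k
    show "coeff (sharp d (q - [:z:])) k = coeff (sharp d q - smult (cnj z) (monom 1 d)) k"
      by (auto simp: sharp_def coeff_sum if_distrib coeff_pCons split: nat.split cong: if_cong)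
  qed
  have v: "vee (sharp d (q - [:z:])) = smult (cnj z) (- B) + A" for z
    by (simp add: sh A_def B_def vee_def pcompose_diff pcompose_smult)
  have S: "S_op q n f (\<lambda>_. z) = (\<Sum>i\<le>n. c i * z ^ i)" for z
  proof -
    have "(smult (cnj z) (- B) + A) ^ n =
        (\<Sum>i\<le>n. smult (cnj z ^ i) (of_nat (n choose i) * (- B) ^ i * A ^ (n - i)))"
      unfolding binomial_ring by (simp only: smult_power mult_smult_left mult_smult_right)
    then have "S_op q n f (\<lambda>_. z) = (\<Sum>k\<le>n * d. \<Sum>i\<le>n. 1 / of_nat ((n * d) choose k) *
        coeff (f \<circ>\<^sub>p q) k * (z ^ i * cnj (coeff (of_nat (n choose i) * (- B) ^ i * A ^ (n - i)) k)))"
      unfolding S_op_def d_def[symmetric] v fischer_def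
      by (simp add: coeff_sum sum_distrib_left)
    also have "\<dots> = (\<Sum>i\<le>n. c i * z ^ i)"
      unfolding c_def by (subst sum.swap) (simp add: sum_distrib_left mult_ac)
    finally show ?thesis .
  qed
  show ?thesis
    by (intro exI[of _ "\<Sum>i\<le>n. monom (c i) i"] conjI degree_sum_le)
       (auto simp: S poly_sum poly_monom intro: order_trans[OF degree_monom_le])
qed

lemma T_op_eqI:
  assumes "\<And>z. poly p z = S_op q n f (\<lambda>_. z)"
  shows "T_op q n f = p"
  unfolding T_op_def using assms by (intro the_equality) (auto simp: poly_eq_poly_eq_iff[symmetric])

lemma poly_T_op: "poly (T_op q n f) z = S_op q n f (\<lambda>_. z)"
  using T_op_aux[of n q f] T_op_eqI by metis

lemma degree_T_op: "degree (T_op q n f) \<le> n"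
  using T_op_aux[of n q f] T_op_eqI by metis

end

(* By multiplicativity of sharp and vee, T f (u) = [f o q, (q - u)^n]. Expanding (q - u)^n
   by the binomial theorem and using linearity of the apolarity form gives
   coeff (T f) i = (-1)^i * (n choose i) * [f o q, q^(n - i)]. Summing these against the
   coefficients of g rebuilds g o q in the second argument. *)
theory Submission
  imports Defs
begin

lemma coeff_vee: "coeff (vee f) k = (-1) ^ k * coeff f k"
  by (simp add: vee_def coeff_pcompose_linear)

lemma vee_power: "vee (f ^ n) = vee f ^ n"
  by (induction n) (simp_all add: vee_def pcompose_mult pcompose_1)

lemma coeff_sharp: "coeff (sharp m f) k = (if k \<le> m then cnj (coeff f (m - k)) else 0)"
  by (simp add: sharp_def coeff_sum)

text \<open>For \<open>z \<noteq> 0\<close> both sides evaluate to \<open>z ^ (a + b)\<close> times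
  the conjugate of the product of the values of \<open>f\<close> and \<open>g\<close> at
  \<open>1 / cnj z\<close>. The ambient degrees add, even if they exceed the true degrees.\<close>

lemma sharp_mult:
  assumes "degree f \<le> a" "degree g \<le> b"
  shows "sharp (a + b) (f * g) = sharp a f * sharp b g"
proof -
  have deg: "degree (f * g) \<le> a + b"
    using assms degree_mult_le[of f g] by linarith
  \<comment> \<open>\<open>poly_sharp\<close> says nothing at 0. The factor \<open>[:0, 1:]\<close>
    makes the product vanish there too, and is cancelled at the end.\<close>
  have "poly ([:0, 1:] * (sharp (a + b) (f * g) - sharp a f * sharp b g)) z = 0" for z
    by (cases "z = 0") (simp_all add: poly_sharp[OF deg] poly_sharp[OF assms(1)]
        poly_sharp[OF assms(2)] power_add)
  then have "[:0, 1:] * (sharp (a + b) (f * g) - sharp a f * sharp b g) = 0"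
    using poly_all_0_iff_0 by blast
  then show ?thesis
    by simp
qed

lemma sharp_power:
  assumes "degree f \<le> m"
  shows "sharp (n * m) (f ^ n) = sharp m f ^ n"
proof (induction n)
  case 0
  show ?case
    by (simp add: sharp_def)
next
  case (Suc n)
  have "degree (f ^ n) \<le> n * m"
    using degree_power_le[of f n] assms by (metis mult.commute mult_le_mono1 order_trans)
  with Suc sharp_mult[OF assms] show ?case
    by simp
qed

text \<open>The conjugation in \<open>sharp\<close> undoes the one in \<open>fischer\<close>, so the
  form is linear, not conjugate-linear, in its second argument.\<close>

lemma apolar_altdef:
  "apolar m f g = (\<Sum>k\<le>m. (-1) ^ k / of_nat (m choose k) * coeff f k * coeff g (m - k))"
  by (simp add: apolar_def fischer_def coeff_vee coeff_sharp mult_ac)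

lemma apolar_smult_right: "apolar m f (smult c g) = c * apolar m f g"
  by (simp add: apolar_altdef sum_distrib_left mult_ac)

lemma apolar_sum_right: "apolar m f (\<Sum>i\<in>I. g i) = (\<Sum>i\<in>I. apolar m f (g i))"
  by (simp add: apolar_altdef coeff_sum sum_distrib_left sum.swap[of _ I])

lemma poly_T_op_apolar:
  "poly (T_op q n f) u = apolar (n * degree q) (f \<circ>\<^sub>p q) ((q - [:u:]) ^ n)"
proof -
  have "degree (q - [:u:]) \<le> degree q"
    by (simp add: degree_diff_le)
  then show ?thesis
    by (simp add: poly_T_op S_op_def apolar_def sharp_power vee_power)
qed

lemma coeff_T_op:
  assumes "i \<le> n"
  shows "coeff (T_op q n f) i =
    (-1) ^ i * of_nat (n choose i) * apolar (n * degree q) (f \<circ>\<^sub>p q) (q ^ (n - i))"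
proof -
  define c where
    "c i = (-1) ^ i * of_nat (n choose i) * apolar (n * degree q) (f \<circ>\<^sub>p q) (q ^ (n - i))" for i
  have "poly (T_op q n f) u = poly (\<Sum>i\<le>n. monom (c i) i) u" for u
  proof -
    \<comment> \<open>With the constant as first summand, the index \<open>i\<close> of
      \<open>binomial_ring\<close> is the exponent of \<open>- u\<close>, hence the degree in
      \<open>u\<close>.\<close>
    have "(q - [:u:]) ^ n = ([:- u:] + q) ^ n"
      by (simp add: diff_conv_add_uminus add.commute del: add_uminus_conv_diff)
    also have "\<dots> = (\<Sum>i\<le>n. smult ((- u) ^ i * of_nat (n choose i)) (q ^ (n - i)))"
      unfolding binomial_ring
      by (simp add: poly_const_pow of_nat_poly mult_ac)
    finally show ?thesis
      by (simp add: poly_T_op_apolar apolar_sum_right apolar_smult_right poly_sum poly_monom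
          c_def power_minus[of u] mult_ac)
  qed
  then have "T_op q n f = (\<Sum>i\<le>n. monom (c i) i)"
    by (simp add: poly_eq_poly_eq_iff[symmetric] fun_eq_iff)
  with assms show ?thesis
    by (simp add: coeff_sum c_def)
qed

lemma pcompose_eq_sum:
  fixes g q :: "'a::comm_semiring_1 poly"
  assumes "degree g \<le> n"
  shows "g \<circ>\<^sub>p q = (\<Sum>k\<le>n. smult (coeff g k) (q ^ k))"
proof -
  have "g \<circ>\<^sub>p q = (\<Sum>k\<le>degree g. smult (coeff g k) (q ^ k))"
    by (simp add: pcompose_altdef poly_altdef degree_map_poly coeff_map_poly)
  also have "\<dots> = (\<Sum>k\<le>n. smult (coeff g k) (q ^ k))"
    using assms by (intro sum.mono_neutral_left) (auto simp: coeff_eq_0)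
  finally show ?thesis .
qed

theorem proposition3p2:
  fixes q f g :: "complex poly" and n d :: nat
  assumes "lead_coeff q = 1" and "degree q = d"
    and "degree f \<le> n" and "degree g \<le> n"
  shows "apolar (n * d) (f \<circ>\<^sub>p q) (g \<circ>\<^sub>p q) = apolar n (T_op q n f) g"
proof -
  have "apolar (n * d) (f \<circ>\<^sub>p q) (g \<circ>\<^sub>p q) =
      (\<Sum>k\<le>n. coeff g k * apolar (n * d) (f \<circ>\<^sub>p q) (q ^ k))"
    by (simp add: pcompose_eq_sum[OF assms(4)] apolar_sum_right apolar_smult_right)
  \<comment> \<open>Reversing the index pairs \<open>coeff g (n - i)\<close> with index
    \<open>i\<close>, as in \<open>apolar_altdef\<close>.\<close>
  also have "\<dots> = (\<Sum>i\<le>n. coeff g (n - i) * apolar (n * d) (f \<circ>\<^sub>p q) (q ^ (n - i)))"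
    by (rule sum.reindex_bij_witness[of _ "\<lambda>k. n - k" "\<lambda>k. n - k"]) auto
  also have "\<dots> = apolar n (T_op q n f) g"
    unfolding apolar_altdef[of n]
    \<comment> \<open>The weight \<open>1 / (n choose i)\<close> of the form cancels the binomial in
      \<open>coeff_T_op\<close>, and the two signs \<open>(-1) ^ i\<close> multiply to 1.\<close>
    by (intro sum.cong) (auto simp: coeff_T_op assms(2) simp flip: power_add mult_2)
  finally show ?thesis .
qed

end
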